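(* Let $n,N,D\in\mathbb{N}$, let $\mathcal{X}\subseteq\mathbb{R}^n$ be the set of feasible solutions, let $\bm{c}_1,\ldots,\bm{c}_N\in\mathbb{R}^n$ be cost vectors, and let $$M=\max_{i\in[n]}\Big\{\max_{j\in[N]}c_{j,i}-\min_{j\in[N]}c_{j,i}\Big\}.$$ Suppose that either $\mathcal{U}=\mathcal{U}_{glob}(\Gamma^{\text{glob}})$ with $\Gamma^{\text{glob}}>D\cdot N\cdot M$, or $\mathcal{U}=\mathcal{U}_{loc}(\Gamma^{\text{loc}})$ with $\Gamma^{\text{loc}}>D\cdot M$. Then the heuristics $\mathrm{H}_{\text{tree}}$ and $\mathrm{H}_{\text{alt}}$ (defined in the context) each obtain an optimal solution of $$\min_{T\in\mathcal{T}}\ \max_{(\bm{\xi}_1,\ldots,\bm{\xi}_N)\in\mathcal{U}}\ \sum_{j\in[N]}\bm{c}_j^\top T(\bm{c}_j+\bm{\xi}_j),$$ where $\mathcal{T}$ is the set of univariate decision trees of depth $D$.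
   Context: Notation: $[N]=\{1,\ldots,N\}$; $c_{j,i}$ is the $i$-th entry of $\bm{c}_j$. A univariate decision tree of depth $D$ is a complete binary tree of depth $D$ (with $2^D$ leaves). Each inner node carries a split, i.e. an item $i\in[n]$ and a threshold $\theta\in[\min_{j\in[N]}c_{j,i},\max_{j\in[N]}c_{j,i}]$; each leaf $k$ carries a solution $\bm{x}_k\in\mathcal{X}$. Such a tree defines a map $T:\mathbb{R}^n\to\mathcal{X}$: given $\hat{\bm{c}}\in\mathbb{R}^n$, start at the root; at an inner node with item $i$ and threshold $\theta$ go to the left child if $\hat c_i\le\theta$ and to the right child if $\hat c_i>\theta$; $T(\hat{\bm{c}})$ is the solution carried by the leaf that is reached. Uncertainty sets: $$\mathcal{U}_{glob}(\Gamma)=\Big\{(\bm{\xi}_1,\ldots,\bm{\xi}_N)^\top\in\mathbb{R}^{N\times n}:\ \sum_{j\in[N]}\sum_{i\in[n]}|\xi_{j,i}|\le\Gamma\Big\},$$ $$\mathcal{U}_{loc}(\Gamma)=\Big\{(\bm{\xi}_1,\ldots,\bm{\xi}_N)^\top\in\mathbb{R}^{N\times n}:\ \sum_{i\in[n]}|\xi_{j,i}|\le\Gamma\ \ \forall j\in[N]\Big\}.$$ The robust value of a tree $T$ is $\max_{(\bm{\xi}_1,\ldots,\bm{\xi}_N)\in\mathcal{U}}\sum_{j\in[N]}\bm{c}_j^\top T(\bm{c}_j+\bm{\xi}_j)$. Heuristic $\mathrm{H}_{\text{tree}}$: repeat until a time limit is reached: choose at random a split (item and admissible threshold, taken from a finite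 set of midpoints between consecutive sorted observed values of the item) for every inner node; with these splits fixed, compute leaf solutions $\bm{x}_k\in\mathcal{X}$ that minimize the robust value of the resulting tree. Return the tree with smallest robust value among those found. Heuristic $\mathrm{H}_{\text{alt}}$: repeat until a time limit is reached: perform one iteration of $\mathrm{H}_{\text{tree}}$ (random splits, then optimal leaf solutions for these splits); then alternate between (i) fixing the current leaf solutions and computing splits (with thresholds from the same finite candidate sets) that minimize the robust value, and (ii) fixing the current splits and computing leaf solutions that minimize the robust value, until both steps give the same objective value. Return the tree with smallest robust value encountered. It is assumed that all subproblems are solved exactly (their minima being attained), that the candidate threshold sets are nonempty, and that the time limit allows at least one iteration of the outer loop to be completed; $\mathcal{X}$ is nonempty. *)

theory Defs
  imports "HOL-Analysis.Analysis" "HOL-Library.Multiset"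
begin

text \<open>
  Cost vectors and perturbations are matrices of type \<open>real ^ 'n ^ 'N\<close>: the \<open>j\<close>-th row of \<open>c\<close>
  is the cost vector \<open>c\<^sub>j\<close>, the number of items is \<open>CARD('n)\<close> and the number of observations
  is \<open>CARD('N)\<close>.
\<close>

datatype (splits: 's, solutions: 'x) dtree =
  Leaf 'x
| Node 's "('s, 'x) dtree" "('s, 'x) dtree"

type_synonym 'n decision_tree = "('n \<times> real, real ^ 'n) dtree"

fun has_depth :: "nat \<Rightarrow> ('s, 'x) dtree \<Rightarrow> bool" where
  "has_depth 0 (Leaf x) = True"
| "has_depth (Suc d) (Node s l r) = (has_depth d l \<and> has_depth d r)"
| "has_depth _ _ = False"

fun decide :: "'n::finite decision_tree \<Rightarrow> real ^ 'n \<Rightarrow> real ^ 'n" where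
  "decide (Leaf x) y = x"
| "decide (Node (i, \<theta>) l r) y = (if y $ i \<le> \<theta> then decide l y else decide r y)"

definition min_cost :: "real ^ 'n ^ 'N \<Rightarrow> 'n \<Rightarrow> real" where
  "min_cost c i = Min (range (\<lambda>j. c $ j $ i))"

definition max_cost :: "real ^ 'n ^ 'N \<Rightarrow> 'n \<Rightarrow> real" where
  "max_cost c i = Max (range (\<lambda>j. c $ j $ i))"

definition max_spread :: "real ^ 'n ^ 'N \<Rightarrow> real" where
  "max_spread c = Max (range (\<lambda>i. max_cost c i - min_cost c i))"

definition trees ::
  "real ^ 'n ^ 'N \<Rightarrow> (real ^ 'n) set \<Rightarrow> nat \<Rightarrow> 'n::finite decision_tree set" where
  "trees c X D = {T. has_depth D T \<and> solutions T \<subseteq> X \<and>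
     (\<forall>(i, \<theta>) \<in> splits T. \<theta> \<in> {min_cost c i..max_cost c i})}"

definition U_glob :: "real \<Rightarrow> (real ^ 'n::finite ^ 'N::finite) set" where
  "U_glob \<Gamma> = {\<xi>. (\<Sum>j\<in>UNIV. \<Sum>i\<in>UNIV. \<bar>\<xi> $ j $ i\<bar>) \<le> \<Gamma>}"

definition U_loc :: "real \<Rightarrow> (real ^ 'n::finite ^ 'N::finite) set" where
  "U_loc \<Gamma> = {\<xi>. \<forall>j. (\<Sum>i\<in>UNIV. \<bar>\<xi> $ j $ i\<bar>) \<le> \<Gamma>}"

text \<open>
  The set below is finite for every \<open>U\<close>, since a tree carries only finitely many solutions; so
  the maximum exists whenever \<open>U\<close> is nonempty.
\<close>

definition robust_value ::
  "real ^ 'n ^ 'N::finite \<Rightarrow> (real ^ 'n ^ 'N) set \<Rightarrow> 'n::finite decision_tree \<Rightarrow> real" where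
  "robust_value c U T = Max ((\<lambda>\<xi>. \<Sum>j\<in>UNIV. (c $ j) \<bullet> decide T (c $ j + \<xi> $ j)) ` U)"

definition optimal_tree ::
  "real ^ 'n ^ 'N::finite \<Rightarrow> (real ^ 'n ^ 'N) set \<Rightarrow> (real ^ 'n) set \<Rightarrow> nat \<Rightarrow>
   'n::finite decision_tree \<Rightarrow> bool" where
  "optimal_tree c U X D T \<longleftrightarrow> is_arg_min (robust_value c U) (\<lambda>T. T \<in> trees c X D) T"

text \<open>
  Consecutive observed values are taken with multiplicity, so an observed value that occurs
  repeatedly counts as a midpoint as well. Candidate sets are arbitrary subsets of these midpoints,
  which includes the variant where only distinct observed values are used.
\<close>

definition midpoints :: "real ^ 'n ^ 'N::finite \<Rightarrow> 'n \<Rightarrow> real set" where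
  "midpoints c i =
     (let v = sorted_list_of_multiset (image_mset (\<lambda>j. c $ j $ i) (mset_set UNIV))
      in {(v ! k + v ! Suc k) / 2 | k. Suc k < length v})"

text \<open>
  Trees whose leaves (resp. inner nodes) carry \<open>()\<close> represent a choice of splits (resp. of leaf
  solutions) alone.
\<close>

definition split_part :: "('s, 'x) dtree \<Rightarrow> ('s, unit) dtree" where
  "split_part = map_dtree id (\<lambda>_. ())"

definition leaf_part :: "('s, 'x) dtree \<Rightarrow> (unit, 'x) dtree" where
  "leaf_part = map_dtree (\<lambda>_. ()) id"

definition candidate_splits :: "nat \<Rightarrow> ('n \<Rightarrow> real set) \<Rightarrow> ('n \<times> real, unit) dtree \<Rightarrow> bool" where
  "candidate_splits D \<Theta> S \<longleftrightarrow> has_depth D S \<and> (\<forall>(i, \<theta>) \<in> splits S. \<theta> \<in> \<Theta> i)"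

definition opt_leaves ::
  "real ^ 'n ^ 'N::finite \<Rightarrow> (real ^ 'n ^ 'N) set \<Rightarrow> (real ^ 'n) set \<Rightarrow>
   ('n \<times> real, unit) dtree \<Rightarrow> 'n::finite decision_tree \<Rightarrow> bool" where
  "opt_leaves c U X S T \<longleftrightarrow>
     is_arg_min (robust_value c U) (\<lambda>T. split_part T = S \<and> solutions T \<subseteq> X) T"

definition opt_splits ::
  "real ^ 'n ^ 'N::finite \<Rightarrow> (real ^ 'n ^ 'N) set \<Rightarrow> nat \<Rightarrow> ('n \<Rightarrow> real set) \<Rightarrow>
   (unit, real ^ 'n) dtree \<Rightarrow> 'n::finite decision_tree \<Rightarrow> bool" where
  "opt_splits c U D \<Theta> L T \<longleftrightarrow>
     is_arg_min (robust_value c U)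
       (\<lambda>T. leaf_part T = L \<and> candidate_splits D \<Theta> (split_part T)) T"

text \<open>
  Random choices, ties between minimizers and the number of iterations completed before the time
  limit are nondeterministic: the predicates below describe all possible outcomes of the
  heuristics.
\<close>

definition H_tree_iteration ::
  "real ^ 'n ^ 'N::finite \<Rightarrow> (real ^ 'n ^ 'N) set \<Rightarrow> (real ^ 'n) set \<Rightarrow> nat \<Rightarrow> ('n \<Rightarrow> real set) \<Rightarrow>
   'n::finite decision_tree \<Rightarrow> bool" where
  "H_tree_iteration c U X D \<Theta> T \<longleftrightarrow> (\<exists>S. candidate_splits D \<Theta> S \<and> opt_leaves c U X S T)"

text \<open>\<open>Ts\<close> lists the trees found in the completed iterations; there is at least one.\<close>

definition H_tree_returns ::
  "real ^ 'n ^ 'N::finite \<Rightarrow> (real ^ 'n ^ 'N) set \<Rightarrow> (real ^ 'n) set \<Rightarrow> nat \<Rightarrow> ('n \<Rightarrow> real set) \<Rightarrow>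
   'n::finite decision_tree \<Rightarrow> bool" where
  "H_tree_returns c U X D \<Theta> T \<longleftrightarrow>
     (\<exists>Ts. Ts \<noteq> [] \<and> (\<forall>T' \<in> set Ts. H_tree_iteration c U X D \<Theta> T') \<and>
           is_arg_min (robust_value c U) (\<lambda>T. T \<in> set Ts) T)"

text \<open>
  \<open>alternation c U X D \<Theta> T Ts\<close>: the alternating phase started with the tree \<open>T\<close> can terminate after
  having computed, in this order, the trees \<open>Ts\<close>.
\<close>

inductive alternation ::
  "real ^ 'n ^ 'N::finite \<Rightarrow> (real ^ 'n ^ 'N) set \<Rightarrow> (real ^ 'n) set \<Rightarrow> nat \<Rightarrow> ('n \<Rightarrow> real set) \<Rightarrow>
   'n::finite decision_tree \<Rightarrow> 'n decision_tree list \<Rightarrow> bool"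
  for c U X D \<Theta> where
  stop: "opt_splits c U D \<Theta> (leaf_part T) T1 \<Longrightarrow> opt_leaves c U X (split_part T1) T2 \<Longrightarrow>
    robust_value c U T1 = robust_value c U T2 \<Longrightarrow> alternation c U X D \<Theta> T [T1, T2]"
| continue: "opt_splits c U D \<Theta> (leaf_part T) T1 \<Longrightarrow> opt_leaves c U X (split_part T1) T2 \<Longrightarrow>
    robust_value c U T1 \<noteq> robust_value c U T2 \<Longrightarrow> alternation c U X D \<Theta> T2 Ts \<Longrightarrow>
    alternation c U X D \<Theta> T (T1 # T2 # Ts)"

definition H_alt_iteration ::
  "real ^ 'n ^ 'N::finite \<Rightarrow> (real ^ 'n ^ 'N) set \<Rightarrow> (real ^ 'n) set \<Rightarrow> nat \<Rightarrow> ('n \<Rightarrow> real set) \<Rightarrow>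
   'n::finite decision_tree list \<Rightarrow> bool" where
  "H_alt_iteration c U X D \<Theta> Ts \<longleftrightarrow>
     (\<exists>T Ts'. H_tree_iteration c U X D \<Theta> T \<and> alternation c U X D \<Theta> T Ts' \<and> Ts = T # Ts')"

definition H_alt_returns ::
  "real ^ 'n ^ 'N::finite \<Rightarrow> (real ^ 'n ^ 'N) set \<Rightarrow> (real ^ 'n) set \<Rightarrow> nat \<Rightarrow> ('n \<Rightarrow> real set) \<Rightarrow>
   'n::finite decision_tree \<Rightarrow> bool" where
  "H_alt_returns c U X D \<Theta> T \<longleftrightarrow>
     (\<exists>Tss. Tss \<noteq> [] \<and> (\<forall>Ts \<in> set Tss. H_alt_iteration c U X D \<Theta> Ts) \<and>
            is_arg_min (robust_value c U) (\<lambda>T. T \<in> set (concat Tss)) T)"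

end

theory Submission
  imports Defs
begin

text \<open>
  A tree asks about at most \<open>D\<close> items on the path followed by \<open>c\<^sub>1\<close>. Moving these coordinates of
  every \<open>c\<^sub>j\<close> to those of \<open>c\<^sub>1\<close> costs at most \<open>D M\<close> per observation, so the adversary can send all
  observations to the leaf of \<open>c\<^sub>1\<close>. Hence no tree beats the best constant solution. Conversely
  every choice of splits can realize constant solutions, so optimal leaf solutions for arbitrary
  splits are already globally optimal. In the alternating phase such a tree is a fixed point of
  both steps.
\<close>

section \<open>Decision paths, and trees as splits plus leaf solutions\<close>

fun path_items :: "'n::finite decision_tree \<Rightarrow> real ^ 'n \<Rightarrow> 'n set" where
  "path_items (Leaf x) y = {}"
| "path_items (Node (i, \<theta>) l r) y =
     insert i (if y $ i \<le> \<theta> then path_items l y else path_items r y)"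

text \<open>Each level of the descent contributes one item, and an item tested repeatedly is counted
  once. The bound limits how many coordinates the adversary has to change.\<close>

lemma card_path_items: "has_depth d T \<Longrightarrow> card (path_items T y) \<le> d"
proof (induction d T rule: has_depth.induct)
  case (2 d s l r)
  show ?case
    using 2 by (cases s) (auto intro!: order_trans[OF card_insert_le_m1])
qed auto

text \<open>Only the items tested on the path of \<open>y\<close> are ever compared, so agreement on
  them makes \<open>z\<close> take the same turn at every node.\<close>

lemma decide_cong:
  "(\<And>i. i \<in> path_items T y \<Longrightarrow> z $ i = y $ i) \<Longrightarrow> decide T z = decide T y"
  by (induction T y rule: path_items.induct) auto

lemma decide_in_solutions: "decide T y \<in> solutions T"
  by (induction T y rule: decide.induct) auto

lemma finite_solutions: "finite (solutions T)"
  by (induction T) auto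

lemma has_depth_map: "has_depth d (map_dtree f g T) \<longleftrightarrow> has_depth d T"
  by (induction d T rule: has_depth.induct) auto

text \<open>Allows the leaves of a split skeleton to be filled freely without leaving the search
  space of \<open>opt_leaves\<close>.\<close>

lemma split_part_map: "split_part (map_dtree id g S) = (S :: ('s, unit) dtree)"
  by (induction S) (auto simp: split_part_def)

lemma splits_split_part: "splits (split_part T) = splits T"
  by (simp add: split_part_def dtree.set_map)

lemma solutions_leaf_part: "solutions (leaf_part T) = solutions T"
  by (simp add: leaf_part_def dtree.set_map)

lemma has_depth_split_part: "has_depth d (split_part T) \<longleftrightarrow> has_depth d T"
  by (simp add: split_part_def has_depth_map)

text \<open>The split \<open>s\<close> is repeated at every inner node. The inclusion covers depth
  0, where no split occurs.\<close>

lemma ex_tree_of_depth: "\<exists>S :: ('s, unit) dtree. has_depth d S \<and> splits S \<subseteq> {s}"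
proof (induction d)
  case 0
  show ?case by (rule exI[of _ "Leaf ()"]) simp
next
  case (Suc d)
  then obtain S :: "('s, unit) dtree" where "has_depth d S" "splits S \<subseteq> {s}" by blast
  then show ?case by (intro exI[of _ "Node s S S"]) simp
qed

lemma ex_candidate_splits:
  assumes "\<And>i. \<Theta> i \<noteq> {}"
  shows "\<exists>S. candidate_splits D \<Theta> S"
proof -
  \<comment> \<open>Types are nonempty, so an item exists; one candidate threshold for it serves at
    all inner nodes.\<close>
  fix i :: 'a
  obtain \<theta> where "\<theta> \<in> \<Theta> i" using assms[of i] by blast
  moreover obtain S :: "('a \<times> real, unit) dtree" where "has_depth D S" "splits S \<subseteq> {(i, \<theta>)}"
    using ex_tree_of_depth[of D "(i, \<theta>)"] by blast
  ultimately have "candidate_splits D \<Theta> S"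
    by (auto simp: candidate_splits_def)
  then show ?thesis ..
qed

section \<open>Cost ranges and feasibility of candidate splits\<close>

lemma min_cost_le: "min_cost c i \<le> (c :: real ^ 'n ^ 'N::finite) $ j $ i"
  unfolding min_cost_def by (rule Min_le) auto

lemma max_cost_ge: "(c :: real ^ 'n ^ 'N::finite) $ j $ i \<le> max_cost c i"
  unfolding max_cost_def by (rule Max_ge) auto

lemma abs_diff_le_max_spread:
  fixes c :: "real ^ 'n::finite ^ 'N::finite"
  shows "\<bar>c $ k $ i - c $ j $ i\<bar> \<le> max_spread c"
proof -
  have "max_cost c i - min_cost c i \<le> max_spread c"
    unfolding max_spread_def by (rule Max_ge) auto
  then show ?thesis
    using min_cost_le[of c i k] min_cost_le[of c i j] max_cost_ge[of c k i] max_cost_ge[of c j i]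
    by linarith
qed

text \<open>All observed values lie in the interval, and so does the mean of two of them.\<close>

lemma midpoints_subset: "midpoints c i \<subseteq> {min_cost c i..max_cost c i}"
proof
  fix \<theta> assume "\<theta> \<in> midpoints c i"
  define v where "v = sorted_list_of_multiset (image_mset (\<lambda>j. c $ j $ i) (mset_set UNIV))"
  obtain k where k: "\<theta> = (v ! k + v ! Suc k) / 2" "Suc k < length v"
    using \<open>\<theta> \<in> midpoints c i\<close> by (auto simp: midpoints_def v_def Let_def)
  have "set v = range (\<lambda>j. c $ j $ i)"
    by (simp add: v_def)
  then have "x \<in> {min_cost c i..max_cost c i}" if "x \<in> set v" for x
    using that by (auto simp: min_cost_le max_cost_ge)
  from this[of "v ! k"] this[of "v ! Suc k"] show "\<theta> \<in> {min_cost c i..max_cost c i}"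
    using k by auto
qed

lemma candidate_splits_in_trees:
  assumes "candidate_splits D \<Theta> (split_part T)" "solutions T \<subseteq> X"
    and "\<And>i. \<Theta> i \<subseteq> midpoints c i"
  shows "T \<in> trees c X D"
proof -
  have "\<theta> \<in> {min_cost c i..max_cost c i}" if "(i, \<theta>) \<in> splits T" for i \<theta>
    using that assms(1) assms(3)[of i] midpoints_subset[of c i]
    unfolding candidate_splits_def splits_split_part by blast
  then show ?thesis
    using assms(1,2) unfolding trees_def candidate_splits_def has_depth_split_part by blast
qed

section \<open>Robust values and the adversary's lower bound\<close>

lemma finite_robust_values:
  fixes c :: "real ^ 'n::finite ^ 'N::finite"
  shows "finite ((\<lambda>\<xi>. \<Sum>j\<in>UNIV. (c $ j) \<bullet> decide T (c $ j + \<xi> $ j)) ` U)"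
proof (rule finite_subset)
  \<comment> \<open>The cost depends on \<open>\<xi>\<close> only through the leaf solution assigned
    to each observation, and there are finitely many such assignments even if \<open>U\<close> is
    infinite.\<close>
  show "(\<lambda>\<xi>. \<Sum>j\<in>UNIV. (c $ j) \<bullet> decide T (c $ j + \<xi> $ j)) ` U
      \<subseteq> (\<lambda>f. \<Sum>j\<in>UNIV. (c $ j) \<bullet> f j) ` Pi\<^sub>E UNIV (\<lambda>_. solutions T)"
  proof (rule image_subsetI)
    fix \<xi> :: "real ^ 'n ^ 'N"
    have "(\<lambda>j. decide T (c $ j + \<xi> $ j)) \<in> Pi\<^sub>E UNIV (\<lambda>_. solutions T)"
      by (simp add: PiE_UNIV_domain decide_in_solutions)
    then show "(\<Sum>j\<in>UNIV. (c $ j) \<bullet> decide T (c $ j + \<xi> $ j))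
        \<in> (\<lambda>f. \<Sum>j\<in>UNIV. (c $ j) \<bullet> f j) ` Pi\<^sub>E UNIV (\<lambda>_. solutions T)"
      by (rule rev_image_eqI) simp
  qed
  show "finite ((\<lambda>f. \<Sum>j\<in>UNIV. (c $ j) \<bullet> f j) ` Pi\<^sub>E (UNIV :: 'N set) (\<lambda>_. solutions T))"
    by (intro finite_imageI finite_PiE) (auto simp: finite_solutions)
qed

lemma robust_value_constant:
  fixes c :: "real ^ 'n::finite ^ 'N::finite"
  assumes "solutions T \<subseteq> {x}" "U \<noteq> {}"
  shows "robust_value c U T = (\<Sum>j\<in>UNIV. (c $ j) \<bullet> x)"
proof -
  have "decide T y = x" for y
    using decide_in_solutions[of T y] assms(1) by auto
  then show ?thesis
    using assms(2) by (simp add: robust_value_def image_constant_conv)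
qed

text \<open>Adding up the budgets of all observations gives the global budget. This lets one
  inclusion treat both uncertainty sets.\<close>

lemma U_loc_subset_U_glob: "(U_loc \<Gamma> :: (real ^ 'n::finite ^ 'N::finite) set) \<subseteq> U_glob (real CARD('N) * \<Gamma>)"
  using sum_bounded_above[of "UNIV :: 'N set" _ \<Gamma>] by (auto simp: U_loc_def U_glob_def)

text \<open>The adversary makes every observation look like a fixed one on the items of its path, so
  all of them receive the same solution \<open>x\<close>. Such a perturbation fits into the local
  budget, which is all that is required of \<open>U\<close>.\<close>

lemma robust_value_ge_constant:
  fixes c :: "real ^ 'n::finite ^ 'N::finite"
  assumes T: "T \<in> trees c X D" and U: "U_loc (real D * max_spread c) \<subseteq> U"
  shows "\<exists>x\<in>X. (\<Sum>j\<in>UNIV. (c $ j) \<bullet> x) \<le> robust_value c U T"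
proof -
  \<comment> \<open>Any observation can serve as the target.\<close>
  obtain j0 :: 'N where True by blast
  define P where "P = path_items T (c $ j0)"
  define x where "x = decide T (c $ j0)"
  define \<xi> :: "real ^ 'n ^ 'N" where
    "\<xi> = (\<chi> j i. if i \<in> P then c $ j0 $ i - c $ j $ i else 0)"
  have M: "0 \<le> max_spread c"
    using abs_diff_le_max_spread[of c j0 undefined j0] by simp
  have card: "card P \<le> D"
    using T card_path_items unfolding P_def trees_def by blast
  have "(\<Sum>i\<in>UNIV. \<bar>\<xi> $ j $ i\<bar>) \<le> real D * max_spread c" for j
  proof -
    have "(\<Sum>i\<in>UNIV. \<bar>\<xi> $ j $ i\<bar>) = (\<Sum>i\<in>P. \<bar>c $ j0 $ i - c $ j $ i\<bar>)"
      by (simp add: \<xi>_def if_distrib[of abs] sum.If_cases)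
    also have "\<dots> \<le> real (card P) * max_spread c"
      by (rule sum_bounded_above) (rule abs_diff_le_max_spread)
    \<comment> \<open>Nonnegativity of the spread is what allows replacing \<open>card P\<close> by
      \<open>D\<close>.\<close>
    also have "\<dots> \<le> real D * max_spread c"
      using card M by (simp add: mult_right_mono)
    finally show ?thesis .
  qed
  then have "\<xi> \<in> U"
    using U by (auto simp: U_loc_def)
  moreover have "decide T (c $ j + \<xi> $ j) = x" for j
    unfolding x_def by (rule decide_cong) (simp add: \<xi>_def P_def)
  ultimately have "(\<Sum>j\<in>UNIV. (c $ j) \<bullet> x) \<le> robust_value c U T"
    unfolding robust_value_def by (intro Max_ge[OF finite_robust_values]) (auto intro!: rev_image_eqI)
  moreover have "x \<in> X"
    using T decide_in_solutions[of T "c $ j0"] by (auto simp: trees_def x_def)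
  ultimately show ?thesis by blast
qed

section \<open>Optimal leaves for any splits, and feasibility of alternation\<close>

lemma opt_leaves_optimal:
  fixes c :: "real ^ 'n::finite ^ 'N::finite"
  assumes opt: "opt_leaves c U X S T" and S: "candidate_splits D \<Theta> S"
    and \<Theta>: "\<And>i. \<Theta> i \<subseteq> midpoints c i"
    and U: "U_loc (real D * max_spread c) \<subseteq> U" "U \<noteq> {}"
  shows "optimal_tree c U X D T"
proof -
  have T: "split_part T = S" "solutions T \<subseteq> X"
    and min: "\<And>T'. split_part T' = S \<Longrightarrow> solutions T' \<subseteq> X \<Longrightarrow> robust_value c U T \<le> robust_value c U T'"
    using opt by (auto simp: opt_leaves_def is_arg_min_linorder)
  have "robust_value c U T \<le> robust_value c U T'" if T': "T' \<in> trees c X D" for T'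
  proof -
    obtain x where x: "x \<in> X" "(\<Sum>j\<in>UNIV. (c $ j) \<bullet> x) \<le> robust_value c U T'"
      using robust_value_ge_constant[OF T' U(1)] by blast
    \<comment> \<open>Putting \<open>x\<close> into every leaf of the given skeleton
      \<open>S\<close> yields a competitor for \<open>T\<close> whose value is the lower bound for
      \<open>T'\<close>.\<close>
    define C where "C = map_dtree id (\<lambda>_. x) S"
    have C: "split_part C = S" "solutions C \<subseteq> {x}"
      by (auto simp: C_def split_part_map dtree.set_map)
    have "robust_value c U T \<le> robust_value c U C"
      using C x(1) by (intro min) auto
    also have "\<dots> = (\<Sum>j\<in>UNIV. (c $ j) \<bullet> x)"
      using C U(2) by (intro robust_value_constant)
    finally show ?thesis using x(2) by simp
  qed
  moreover have "T \<in> trees c X D"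
    using S T candidate_splits_in_trees[of D \<Theta> T, OF _ _ \<Theta>] by simp
  ultimately show ?thesis
    by (simp add: optimal_tree_def is_arg_min_linorder)
qed

text \<open>Optimizing splits keeps the leaf solutions, and optimizing leaves keeps the candidate
  splits. The invariant concerns \<open>solutions T\<close> alone because the next round reads only
  the leaves of \<open>T\<close>.\<close>

lemma alternation_in_trees:
  assumes "alternation c U X D \<Theta> T Ts" "solutions T \<subseteq> X" "T' \<in> set Ts"
    and "\<And>i. \<Theta> i \<subseteq> midpoints c i"
  shows "T' \<in> trees c X D"
proof -
  have step: "T1 \<in> trees c X D" "T2 \<in> trees c X D" "solutions T2 \<subseteq> X"
    if "opt_splits c U D \<Theta> (leaf_part T) T1" "opt_leaves c U X (split_part T1) T2" "solutions T \<subseteq> X"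
    for T T1 T2
  proof -
    have T1: "candidate_splits D \<Theta> (split_part T1)" "leaf_part T1 = leaf_part T"
      and T2: "split_part T2 = split_part T1" "solutions T2 \<subseteq> X"
      using that by (auto simp: opt_splits_def opt_leaves_def is_arg_min_def)
    have "solutions T1 \<subseteq> X"
      using T1(2) that(3) by (metis solutions_leaf_part)
    then show "T1 \<in> trees c X D"
      using candidate_splits_in_trees[OF T1(1) _ assms(4)] by blast
    show "T2 \<in> trees c X D"
      using T1(1) T2 candidate_splits_in_trees[of D \<Theta> T2, OF _ _ assms(4)] by simp
    show "solutions T2 \<subseteq> X"
      by (rule T2(2))
  qed
  show ?thesis
    using assms(1-3)
  proof (induction rule: alternation.induct)
    case (stop T T1 T2)
    then show ?case using step[OF stop(1,2)] by auto
  next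
    case (continue T T1 T2 Ts)
    then show ?case using step[OF continue(1,2)] by auto
  qed
qed

text \<open>Once a pool of feasible trees contains one optimum, its best member is optimal
  too.\<close>

lemma is_arg_min_optimal_tree:
  assumes "is_arg_min (robust_value c U) (\<lambda>T. T \<in> A) T" "A \<subseteq> trees c X D"
    and "T0 \<in> A" "optimal_tree c U X D T0"
  shows "optimal_tree c U X D T"
proof -
  have "T \<in> trees c X D" "robust_value c U T \<le> robust_value c U T0"
    using assms(1-3) by (auto simp: is_arg_min_linorder)
  then show ?thesis
    using assms(4) unfolding optimal_tree_def is_arg_min_linorder by (meson order_trans)
qed

section \<open>Existence and optimality of the outcomes of both heuristics\<close>

theorem corollary4p2:
  fixes c :: "real ^ 'n::finite ^ 'N::finite"
    and X :: "(real ^ 'n) set"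
    and U :: "(real ^ 'n ^ 'N) set"
    and \<Theta> :: "'n \<Rightarrow> real set"
    and D :: nat
    and \<Gamma> :: real
  assumes "X \<noteq> {}"
    and "\<And>i. \<Theta> i \<noteq> {}"
    and "\<And>i. \<Theta> i \<subseteq> midpoints c i"
    and "\<And>S. candidate_splits D \<Theta> S \<Longrightarrow> \<exists>T. opt_leaves c U X S T"
    and "U = U_glob \<Gamma> \<and> \<Gamma> > real D * real CARD('N) * max_spread c
       \<or> U = U_loc \<Gamma> \<and> \<Gamma> > real D * max_spread c"
  shows "(\<exists>T. H_tree_returns c U X D \<Theta> T)
       \<and> (\<forall>T. H_tree_returns c U X D \<Theta> T \<longrightarrow> optimal_tree c U X D T)
       \<and> (\<exists>T. H_alt_returns c U X D \<Theta> T)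
       \<and> (\<forall>T. H_alt_returns c U X D \<Theta> T \<longrightarrow> optimal_tree c U X D T)"
proof -
  have "max_spread c \<ge> 0"
    using abs_diff_le_max_spread[of c undefined undefined undefined] by simp
  have sub: "U_loc (real D * max_spread c) \<subseteq> U"
    using assms(5)
  proof
    assume U: "U = U_glob \<Gamma> \<and> \<Gamma> > real D * real CARD('N) * max_spread c"
    then have "real CARD('N) * (real D * max_spread c) \<le> \<Gamma>"
      by (simp add: mult_ac)
    then have "(U_glob (real CARD('N) * (real D * max_spread c)) :: (real ^ 'n ^ 'N) set) \<subseteq> U_glob \<Gamma>"
      unfolding U_glob_def by (intro Collect_mono impI) linarith
    then show ?thesis
      using U U_loc_subset_U_glob by blast
  next
    assume U: "U = U_loc \<Gamma> \<and> \<Gamma> > real D * max_spread c"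
    then have "real D * max_spread c \<le> \<Gamma>" by simp
    then have "(U_loc (real D * max_spread c) :: (real ^ 'n ^ 'N) set) \<subseteq> U_loc \<Gamma>"
      unfolding U_loc_def by (intro Collect_mono impI all_mono) linarith
    then show ?thesis
      using U by blast
  qed
  have "0 \<in> U_loc (real D * max_spread c)"
    using \<open>max_spread c \<ge> 0\<close> by (simp add: U_loc_def)
  with sub have "U \<noteq> {}" by blast
  have iter: "optimal_tree c U X D T" if "H_tree_iteration c U X D \<Theta> T" for T
    using that opt_leaves_optimal[OF _ _ assms(3) sub \<open>U \<noteq> {}\<close>]
    by (auto simp: H_tree_iteration_def)
  have optimal_in_trees: "T \<in> trees c X D" if "optimal_tree c U X D T" for T
    using that by (simp add: optimal_tree_def is_arg_min_def)

  obtain S T where S: "candidate_splits D \<Theta> S" and T: "opt_leaves c U X S T"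
    using ex_candidate_splits[of \<Theta> D, OF assms(2)] assms(4) by blast
  then have it: "H_tree_iteration c U X D \<Theta> T"
    by (auto simp: H_tree_iteration_def)
  have tree_ex: "H_tree_returns c U X D \<Theta> T"
    unfolding H_tree_returns_def using it by (intro exI[of _ "[T]"]) (simp add: is_arg_min_def)

  have ST: "split_part T = S" "solutions T \<subseteq> X"
    using T by (auto simp: opt_leaves_def is_arg_min_def)
  \<comment> \<open>\<open>T\<close> is already optimal among all trees, hence among those sharing
    its leaf solutions; it may be returned by both alternating steps, which then stop at
    once.\<close>
  have "robust_value c U T \<le> robust_value c U T'"
    if "leaf_part T' = leaf_part T" "candidate_splits D \<Theta> (split_part T')" for T'
  proof -
    have "solutions T' \<subseteq> X"
      using that(1) ST(2) by (metis solutions_leaf_part)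
    then have "T' \<in> trees c X D"
      using candidate_splits_in_trees[OF that(2) _ assms(3)] by blast
    then show ?thesis
      using iter[OF it] by (simp add: optimal_tree_def is_arg_min_linorder)
  qed
  then have "opt_splits c U D \<Theta> (leaf_part T) T"
    using S ST by (simp add: opt_splits_def is_arg_min_linorder)
  then have "alternation c U X D \<Theta> T [T, T]"
    using T ST by (intro alternation.stop) auto
  then have "H_alt_iteration c U X D \<Theta> [T, T, T]"
    using it by (auto simp: H_alt_iteration_def)
  then have alt_ex: "H_alt_returns c U X D \<Theta> T"
    unfolding H_alt_returns_def by (intro exI[of _ "[[T, T, T]]"]) (simp add: is_arg_min_def)

  have tree_opt: "optimal_tree c U X D T" if "H_tree_returns c U X D \<Theta> T" for T
    using that iter unfolding H_tree_returns_def is_arg_min_def by blast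

  have alt_opt: "optimal_tree c U X D T" if "H_alt_returns c U X D \<Theta> T" for T
  proof -
    obtain Tss where Tss: "Tss \<noteq> []" "\<And>Ts. Ts \<in> set Tss \<Longrightarrow> H_alt_iteration c U X D \<Theta> Ts"
      and min: "is_arg_min (robust_value c U) (\<lambda>T. T \<in> set (concat Tss)) T"
      using \<open>H_alt_returns c U X D \<Theta> T\<close> unfolding H_alt_returns_def by blast
    have run: "set Ts \<subseteq> trees c X D" if "H_alt_iteration c U X D \<Theta> Ts" for Ts
    proof -
      obtain T0 Ts' where T0: "H_tree_iteration c U X D \<Theta> T0" "alternation c U X D \<Theta> T0 Ts'"
        "Ts = T0 # Ts'"
        using \<open>H_alt_iteration c U X D \<Theta> Ts\<close> unfolding H_alt_iteration_def by blast
      have "T0 \<in> trees c X D"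
        using T0(1) iter optimal_in_trees by blast
      moreover from this have "solutions T0 \<subseteq> X"
        by (simp add: trees_def)
      ultimately show ?thesis
        using T0(3) alternation_in_trees[OF T0(2) _ _ assms(3)] by auto
    qed
    \<comment> \<open>The initial tree of the first iteration supplies the optimum in the
      pool.\<close>
    have "H_alt_iteration c U X D \<Theta> (hd Tss)"
      using Tss by simp
    then obtain T0 Ts' where T0: "H_tree_iteration c U X D \<Theta> T0" "hd Tss = T0 # Ts'"
      unfolding H_alt_iteration_def by blast
    then have "T0 \<in> set (concat Tss)"
      using Tss(1) by (metis concat.simps(2) hd_Cons_tl append_Cons list.set_intros(1))
    then show ?thesis
      using is_arg_min_optimal_tree[OF min _ _ iter[OF T0(1)]] run Tss(2) by auto
  qed

  show ?thesis
    using tree_ex tree_opt alt_ex alt_opt by blast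
qed

end
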